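(* Let $d\ge 2$ be a constant. There is a randomized algorithm which, given the vertex set $U(\mathcal{H})$ of a $d$-uniform hypergraph $\mathcal{H}$ (whose hyperedges are unknown), a positive integer $k$, and access to a GPIS oracle for $\mathcal{H}$, makes $\mathcal{O}(k^{2d^2}\log k)$ GPIS queries and, with probability at least $1-1/k^{c}$ for some constant $c>0$, correctly decides whether $\mathcal{H}$ has a hitting set (a vertex set intersecting every hyperedge) of size at most $k$.
   Context: The GPIS (generalized $d$-partite independent set) oracle takes as input $d$ pairwise disjoint non-empty subsets $A_1,\dots,A_d\subseteq U(\mathcal{H})$ and answers (yes/no only) whether there exists a hyperedge $\{u_1,\dots,u_d\}$ of $\mathcal{H}$ with $u_i\in A_i$ for all $i\in[d]$. Only oracle queries are counted. *)

theory Defs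
  imports "HOL-Probability.Probability" "HOL-Library.Landau_Symbols"
begin

definition uniform_hypergraph :: "nat \<Rightarrow> 'a set \<Rightarrow> 'a set set \<Rightarrow> bool" where
  "uniform_hypergraph d U F \<longleftrightarrow> finite U \<and> (\<forall>e\<in>F. e \<subseteq> U \<and> card e = d)"

definition hitting_set :: "'a set \<Rightarrow> 'a set set \<Rightarrow> 'a set \<Rightarrow> bool" where
  "hitting_set U F S \<longleftrightarrow> S \<subseteq> U \<and> (\<forall>e\<in>F. S \<inter> e \<noteq> {})"

definition has_hitting_set_of_size_le :: "'a set \<Rightarrow> 'a set set \<Rightarrow> nat \<Rightarrow> bool" where
  "has_hitting_set_of_size_le U F k \<longleftrightarrow> (\<exists>S. hitting_set U F S \<and> card S \<le> k)"

text \<open>A GPIS query is the list of the \<open>d\<close> sets handed to the oracle.\<close>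

definition gpis_query :: "nat \<Rightarrow> 'a set \<Rightarrow> 'a set list \<Rightarrow> bool" where
  "gpis_query d U As \<longleftrightarrow> length As = d \<and> (\<forall>i<d. As ! i \<noteq> {} \<and> As ! i \<subseteq> U)
     \<and> (\<forall>i<d. \<forall>j<d. i \<noteq> j \<longrightarrow> As ! i \<inter> As ! j = {})"

definition gpis_oracle :: "nat \<Rightarrow> 'a set set \<Rightarrow> 'a set list \<Rightarrow> bool" where
  "gpis_oracle d F As \<longleftrightarrow> (\<exists>u. (\<forall>i<d. u i \<in> As ! i) \<and> u ` {..<d} \<in> F)"

text \<open>A deterministic query algorithm is an adaptive decision tree: the next step may depend
  on the yes/no answers received so far, and on nothing else that concerns the hyperedges.
  A randomized query algorithm is a probability distribution over such trees.\<close>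

datatype 'a query_alg = Output bool | Query "'a set list" "bool \<Rightarrow> 'a query_alg"

primrec run :: "('a set list \<Rightarrow> bool) \<Rightarrow> 'a query_alg \<Rightarrow> bool" where
  "run orc (Output b) = b"
| "run orc (Query As g) = run orc (g (orc As))"

text \<open>The sequence of queries actually asked when running against the oracle \<open>orc\<close>.\<close>

primrec queries :: "('a set list \<Rightarrow> bool) \<Rightarrow> 'a query_alg \<Rightarrow> 'a set list list" where
  "queries orc (Output b) = []"
| "queries orc (Query As g) = As # queries orc (g (orc As))"

type_synonym 'a rand_query_alg = "'a query_alg pmf"

end

theory Submission imports Defs
begin

text \<open>Colour the vertices at random with \<open>m = \<Theta>(k\<^sup>2\<^sup>d)\<close> colours and query all \<open>d\<close>-tuples of distinct
  colour classes; the answers describe a hypergraph on at most \<open>m\<close> classes. A hitting set of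
  \<open>\<H>\<close> always projects to one of this hypergraph. Conversely, if \<open>\<H>\<close> has no hitting set of
  size \<open>k\<close>, then neither has a minimal such subfamily, which by the sunflower lemma has only
  \<open>O(k\<^sup>d)\<close> edges: removing one of \<open>k + 2\<close> petals would not change which sets of size at
  most \<open>k\<close> are hitting. By the birthday bound the colouring is injective on its vertices with
  probability at least \<open>1/2\<close>, in which case the hypergraph of classes has no hitting set of size
  \<open>k\<close> either. The error is one-sided, so \<open>\<lceil>log\<^sub>2 k\<rceil>\<close> repetitions reduce it to \<open>1/k\<close>.\<close>

section \<open>Sunflowers and critical subfamilies\<close>

text \<open>Either some \<open>Suc r\<close> edges are pairwise disjoint, a sunflower with empty
  core, or a maximal disjoint subfamily covers few vertices. In the latter case these vertices meet
  every edge, one of them lies in many edges, and induction applies to the edges through it with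
  that vertex removed.\<close>

lemma sunflower:
  fixes F :: "'a set set"
  assumes "finite F" "\<And>A. A \<in> F \<Longrightarrow> finite A \<and> card A = d" "card F > (d * r) ^ d"
  shows "\<exists>P C. P \<subseteq> F \<and> card P = Suc r \<and> (\<forall>A\<in>P. \<forall>B\<in>P. A \<noteq> B \<longrightarrow> A \<inter> B = C)"
  using assms
proof (induction d arbitrary: F)
  case 0
  \<comment> \<open>The bound is \<open>0 ^ 0 = 1\<close> here, and a family of empty sets has at
    most one member.\<close>
  then have "F \<subseteq> {{}}" by (metis card_0_eq singletonI subsetI)
  then have "card F \<le> card {{} :: 'a set}" by (intro card_mono) auto
  with 0 show ?case by simp
next
  case (Suc d)
  define disj where "disj M \<longleftrightarrow> M \<subseteq> F \<and> disjoint M" for M :: "'a set set"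
  have "finite {M. disj M}"
    by (rule finite_subset[of _ "Pow F"]) (auto simp: disj_def Suc.prems)
  moreover have "disj {}" by (auto simp: disj_def)
  ultimately obtain M where M: "disj M" "\<And>N. disj N \<Longrightarrow> M \<subseteq> N \<Longrightarrow> N = M"
    using finite_has_maximal[of "{M. disj M}"] by blast
  have finM: "finite M" and MF: "M \<subseteq> F"
    using M(1) Suc.prems(1) by (auto simp: disj_def intro: finite_subset)
  show ?case
  proof (cases "Suc r \<le> card M")
    case True
    then obtain P where P: "P \<subseteq> M" "card P = Suc r"
      using obtain_subset_with_card_n by metis
    have "\<forall>A\<in>M. \<forall>B\<in>M. A \<noteq> B \<longrightarrow> A \<inter> B = {}"
      using M(1) unfolding disj_def disjoint_def by (rule conjunct2)
    then have "\<forall>A\<in>P. \<forall>B\<in>P. A \<noteq> B \<longrightarrow> A \<inter> B = {}"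
      using P(1) by (simp add: subset_iff)
    with P MF show ?thesis by blast
  next
    case False
    define W where "W = \<Union>M"
    have finW: "finite W" using finM MF Suc.prems(2) by (auto simp: W_def)
    have "card W \<le> (\<Sum>A\<in>M. card A)"
      unfolding W_def by (rule card_Union_le_sum_card)
    also have "\<dots> = card M * Suc d"
      using MF Suc.prems(2) by (subst sum.cong[OF refl, of _ _ "\<lambda>_. Suc d"]) auto
    also have "\<dots> \<le> r * Suc d" using False by (intro mult_right_mono) auto
    finally have cardW: "card W \<le> r * Suc d" .
    define Fx where "Fx x = {A\<in>F. x \<in> A}" for x
    \<comment> \<open>An edge missing \<open>W\<close> could be added to \<open>M\<close>. By
      maximality it is already in \<open>M\<close>, hence inside \<open>W\<close>, hence
      empty.\<close>
    have hits: "F \<subseteq> (\<Union>x\<in>W. Fx x)"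
    proof
      fix A assume A: "A \<in> F"
      show "A \<in> (\<Union>x\<in>W. Fx x)"
      proof (rule ccontr)
        assume "A \<notin> (\<Union>x\<in>W. Fx x)"
        then have AW: "A \<inter> W = {}" using A by (auto simp: Fx_def)
        then have "disj (insert A M)"
          using M(1) A unfolding disj_def disjoint_def W_def by (auto simp: pairwise_insert disjnt_def)
        then have "A \<in> M" using M(2)[of "insert A M"] by auto
        then have "A = {}" using AW by (auto simp: W_def)
        then show False using Suc.prems(2)[OF A] by simp
      qed
    qed
    have "\<exists>x\<in>W. card (Fx x) > (d * r) ^ d"
    proof (rule ccontr)
      assume "\<not> ?thesis"
      then have le: "\<And>x. x \<in> W \<Longrightarrow> card (Fx x) \<le> (d * r) ^ d" by force
      have "card F \<le> card (\<Union>x\<in>W. Fx x)"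
        using finW Suc.prems(1) by (intro card_mono hits) (auto simp: Fx_def)
      also have "\<dots> \<le> (\<Sum>x\<in>W. card (Fx x))" by (rule card_UN_le[OF finW])
      also have "\<dots> \<le> card W * (d * r) ^ d" using sum_bounded_above[OF le] by simp
      \<comment> \<open>Enlarging \<open>d\<close> to \<open>Suc d\<close> in the base turns the
        bound into the threshold of the next uniformity.\<close>
      also have "\<dots> \<le> (r * Suc d) * (Suc d * r) ^ d"
        using cardW by (intro mult_mono power_mono) auto
      also have "\<dots> = (Suc d * r) ^ Suc d" by (simp add: algebra_simps)
      finally show False using Suc.prems(3) by simp
    qed
    then obtain x where x: "card (Fx x) > (d * r) ^ d" by blast
    \<comment> \<open>The link of \<open>x\<close>: distinct edges through \<open>x\<close> stay
      distinct without it, so the induction hypothesis applies. Restoring \<open>x\<close> adds it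
      to the core.\<close>
    define G where "G = (\<lambda>A. A - {x}) ` Fx x"
    have "inj_on (\<lambda>A. A - {x}) (Fx x)" by (auto simp: inj_on_def Fx_def)
    then have "card G > (d * r) ^ d" using x by (simp add: G_def card_image)
    moreover have "finite G" using Suc.prems(1) by (simp add: G_def Fx_def)
    moreover have "\<And>A. A \<in> G \<Longrightarrow> finite A \<and> card A = d"
      using Suc.prems(2) by (auto simp: G_def Fx_def)
    ultimately obtain P C where P: "P \<subseteq> G" "card P = Suc r"
        "\<And>A B. A \<in> P \<Longrightarrow> B \<in> P \<Longrightarrow> A \<noteq> B \<Longrightarrow> A \<inter> B = C"
      using Suc.IH[of G] by metis
    have notin: "x \<notin> A" if "A \<in> P" for A using that P(1) by (auto simp: G_def)
    have inj: "inj_on (insert x) P"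
      using notin by (auto intro!: inj_onI dest: insert_ident[THEN iffD1, rotated 2])
    have "insert x ` P \<subseteq> F"
      using P(1) by (auto simp: G_def Fx_def insert_absorb)
    moreover have "card (insert x ` P) = Suc r" using inj P(2) by (simp add: card_image)
    moreover have "A \<inter> B = insert x C"
      if "A \<in> insert x ` P" "B \<in> insert x ` P" "A \<noteq> B" for A B
    proof -
      obtain A' B' where AB: "A' \<in> P" "B' \<in> P" "A = insert x A'" "B = insert x B'"
        using \<open>A \<in> insert x ` P\<close> \<open>B \<in> insert x ` P\<close> by auto
      then have "A' \<inter> B' = C" using P(3)[of A' B'] \<open>A \<noteq> B\<close> by auto
      then show ?thesis using AB by auto
    qed
    ultimately show ?thesis by (intro exI[of _ "insert x ` P"] exI[of _ "insert x C"]) simp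
  qed
qed

text \<open>In an inclusion-minimal subfamily without a small hitting set, every edge
  \<open>e\<close> matters: some small set hits all the others. A large sunflower contradicts this,
  since a small set hitting all its other petals must meet the core and so also hits
  \<open>e\<close>.\<close>

lemma no_small_hitting_set_subfamily:
  assumes "uniform_hypergraph d U F" "\<not> has_hitting_set_of_size_le U F k"
  shows "\<exists>G\<subseteq>F. \<not> has_hitting_set_of_size_le U G k \<and> card G \<le> (d * Suc k) ^ d"
proof -
  have finU: "finite U" and F: "\<And>e. e \<in> F \<Longrightarrow> e \<subseteq> U \<and> card e = d"
    using assms(1) by (auto simp: uniform_hypergraph_def)
  have finF: "finite F" using F by (intro finite_subset[OF _ finite_Pow_iff[THEN iffD2, OF finU]]) auto
  define crit where "crit = {G. G \<subseteq> F \<and> \<not> has_hitting_set_of_size_le U G k}"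
  have "finite crit"
    by (rule finite_subset[of _ "Pow F"]) (auto simp: crit_def finF)
  moreover have "F \<in> crit" using assms(2) by (simp add: crit_def)
  ultimately obtain G where G: "G \<in> crit" and min: "\<And>H. H \<in> crit \<Longrightarrow> H \<subseteq> G \<Longrightarrow> H = G"
    using finite_has_minimal[of crit] by (metis empty_iff)
  have GF: "G \<subseteq> F" and noG: "\<not> has_hitting_set_of_size_le U G k" using G by (auto simp: crit_def)
  have "card G \<le> (d * Suc k) ^ d"
  proof (rule ccontr)
    assume "\<not> ?thesis"
    moreover have "finite G" using GF finF finite_subset by blast
    moreover have "\<And>A. A \<in> G \<Longrightarrow> finite A \<and> card A = d"
      using F GF finU by (meson finite_subset subsetD)
    ultimately obtain P C where P: "P \<subseteq> G" "card P = Suc (Suc k)"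
        "\<And>A B. A \<in> P \<Longrightarrow> B \<in> P \<Longrightarrow> A \<noteq> B \<Longrightarrow> A \<inter> B = C"
      using sunflower[of G d "Suc k"] by (metis not_le)
    then obtain e where e: "e \<in> P" by fastforce
    have "G - {e} \<notin> crit" using min[of "G - {e}"] e P(1) by blast
    then obtain S where S: "S \<subseteq> U" "card S \<le> k" "\<And>A. A \<in> G - {e} \<Longrightarrow> S \<inter> A \<noteq> {}"
      using GF by (auto simp: crit_def has_hitting_set_of_size_le_def hitting_set_def)
    have "S \<inter> e \<noteq> {}"
    proof
      assume Se: "S \<inter> e = {}"
      have "\<forall>A\<in>P - {e}. \<exists>s. s \<in> S \<inter> A" using S(3) P(1) by blast
      then obtain s where s: "\<And>A. A \<in> P - {e} \<Longrightarrow> s A \<in> S \<inter> A" by metis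
      \<comment> \<open>A point chosen for two petals would lie in the core
        \<open>A \<inter> e\<close>, which \<open>S\<close> avoids. So \<open>S\<close> would need a
        separate point for each of the \<open>Suc k\<close> petals other than
        \<open>e\<close>.\<close>
      have "inj_on s (P - {e})"
      proof (rule inj_onI, rule ccontr)
        fix A B assume AB: "A \<in> P - {e}" "B \<in> P - {e}" "s A = s B" "A \<noteq> B"
        then have "s A \<in> A \<inter> B" using s by (metis IntD2 IntI)
        also have "A \<inter> B = A \<inter> e" using P(3) AB e by (metis Diff_iff singletonI)
        finally show False using s[OF AB(1)] Se by auto
      qed
      then have "card (P - {e}) \<le> card S"
        by (rule card_inj_on_le) (use s S(1) finU finite_subset in auto)
      moreover have "card (P - {e}) = Suc k" using P(2) e by simp
      ultimately show False using S(2) by simp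
    qed
    then have "has_hitting_set_of_size_le U G k"
      using S unfolding has_hitting_set_of_size_le_def hitting_set_def by blast
    with noG show False ..
  qed
  with GF noG show ?thesis by blast
qed

section \<open>Random colourings\<close>

text \<open>The value at \<open>v\<close> is copied from \<open>u\<close>, so such a colouring is
  determined by its restriction to \<open>U - {v}\<close>.\<close>

lemma card_PiE_eq_at_two_points:
  assumes "finite U" "u \<in> U" "v \<in> U" "u \<noteq> v"
  shows "card {h \<in> U \<rightarrow>\<^sub>E {..<m::nat}. h u = h v} \<le> m ^ (card U - 1)"
proof -
  let ?r = "\<lambda>h. restrict h (U - {v})"
  have "inj_on ?r {h \<in> U \<rightarrow>\<^sub>E {..<m}. h u = h v}"
  proof (rule inj_onI)
    fix g h assume g: "g \<in> {h \<in> U \<rightarrow>\<^sub>E {..<m}. h u = h v}"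
      and h: "h \<in> {h \<in> U \<rightarrow>\<^sub>E {..<m}. h u = h v}" and eq: "?r g = ?r h"
    have *: "g x = h x" if "x \<in> U - {v}" for x using fun_cong[OF eq, of x] that by auto
    have "g v = h v" using *[of u] g h assms by auto
    with * have "g x = h x" if "x \<in> U" for x using that by (cases "x = v") auto
    moreover have "g \<in> U \<rightarrow>\<^sub>E {..<m}" "h \<in> U \<rightarrow>\<^sub>E {..<m}" using g h by auto
    ultimately show "g = h" by (intro PiE_ext)
  qed
  moreover have "?r ` {h \<in> U \<rightarrow>\<^sub>E {..<m}. h u = h v} \<subseteq> (U - {v}) \<rightarrow>\<^sub>E {..<m}"
  proof (rule image_subsetI)
    fix h assume "h \<in> {h \<in> U \<rightarrow>\<^sub>E {..<m}. h u = h v}"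
    then have "h \<in> U \<rightarrow>\<^sub>E {..<m}" by blast
    then have "\<forall>x\<in>U - {v}. h x \<in> {..<m}" by blast
    then show "?r h \<in> (U - {v}) \<rightarrow>\<^sub>E {..<m}" by (simp only: restrict_PiE_iff)
  qed
  moreover have "finite ((U - {v}) \<rightarrow>\<^sub>E {..<m})" using assms by (intro finite_PiE) auto
  ultimately have "card {h \<in> U \<rightarrow>\<^sub>E {..<m}. h u = h v} \<le> card ((U - {v}) \<rightarrow>\<^sub>E {..<m})"
    by (rule card_inj_on_le)
  also have "\<dots> = m ^ (card U - 1)" using assms by (simp add: card_PiE)
  finally show ?thesis .
qed

text \<open>The birthday bound in counting form: a union bound over ordered pairs in
  \<open>W\<close>, each of which collides in at most a fraction \<open>1/m\<close> of all
  colourings.\<close>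

lemma card_noninjective_colourings:
  assumes "finite U" "W \<subseteq> U" "2 * (card W)\<^sup>2 \<le> m"
  shows "2 * card {h \<in> U \<rightarrow>\<^sub>E {..<m::nat}. \<not> inj_on h W} \<le> m ^ card U"
proof (cases "W = {}")
  case True
  then show ?thesis by simp
next
  case False
  have finW: "finite W" using assms finite_subset by blast
  define D where "D = {p \<in> W \<times> W. fst p \<noteq> snd p}"
  define N where "N p = {h \<in> U \<rightarrow>\<^sub>E {..<m}. h (fst p) = h (snd p)}" for p
  have finD: "finite D" using finW by (simp add: D_def)
  have "card D \<le> card (W \<times> W)" using finW by (intro card_mono) (auto simp: D_def)
  then have cardD: "card D \<le> (card W)\<^sup>2" by (simp add: card_cartesian_product power2_eq_square)
  have finPi: "finite (U \<rightarrow>\<^sub>E {..<m})" using assms by (intro finite_PiE) auto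
  have "card {h \<in> U \<rightarrow>\<^sub>E {..<m}. \<not> inj_on h W} \<le> card (\<Union>p\<in>D. N p)"
    using finD finPi by (intro card_mono) (auto simp: D_def N_def inj_on_def)
  also have "\<dots> \<le> (\<Sum>p\<in>D. card (N p))" by (rule card_UN_le[OF finD])
  also have "\<dots> \<le> (\<Sum>p\<in>D. m ^ (card U - 1))"
    unfolding N_def using assms(2)
    by (intro sum_mono card_PiE_eq_at_two_points[OF assms(1)]) (auto simp: D_def)
  also have "\<dots> = card D * m ^ (card U - 1)" by simp
  also have "\<dots> \<le> (card W)\<^sup>2 * m ^ (card U - 1)" using cardD by (rule mult_right_mono) simp
  finally have "2 * card {h \<in> U \<rightarrow>\<^sub>E {..<m}. \<not> inj_on h W} \<le> 2 * (card W)\<^sup>2 * m ^ (card U - 1)"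
    by simp
  also have "\<dots> \<le> m * m ^ (card U - 1)" using assms(3) by (rule mult_right_mono) simp
  also have "\<dots> = m ^ card U"
  proof -
    \<comment> \<open>Subtraction is truncated, so \<open>m * m ^ (card U - 1)\<close> is the full
      power only for nonempty \<open>U\<close>. This is why empty \<open>W\<close> was split
      off.\<close>
    have "card U \<noteq> 0" using False assms by auto
    then show ?thesis by (cases "card U") auto
  qed
  finally show ?thesis .
qed

text \<open>Amplification: a uniform list of length \<open>r\<close> consists of \<open>r\<close>
  independent draws. The lists missing \<open>G\<close> are those over \<open>X - G\<close>, a
  fraction of at most \<open>(1/2) ^ r\<close>.\<close>

lemma prob_lists_avoiding:
  assumes "finite X" "X \<noteq> {}" "G \<subseteq> X" "2 * card (X - G) \<le> card X"
  shows "measure_pmf.prob (pmf_of_set {xs. set xs \<subseteq> X \<and> length xs = r}) {xs. set xs \<inter> G \<noteq> {}}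
    \<ge> 1 - 1 / 2 ^ r"
proof -
  let ?L = "{xs. set xs \<subseteq> X \<and> length xs = r}"
  have finL: "finite ?L" using assms(1) by (rule finite_lists_length_eq)
  obtain x where "x \<in> X" using assms(2) by blast
  then have "replicate r x \<in> ?L" by auto
  then have neL: "?L \<noteq> {}" by blast
  have cardX: "card X > 0" using assms by (simp add: card_gt_0_iff)
  have "measure_pmf.prob (pmf_of_set ?L) (UNIV - {xs. set xs \<inter> G \<noteq> {}})
      = card {xs. set xs \<subseteq> X - G \<and> length xs = r} / card ?L"
    by (subst measure_pmf_of_set[OF neL finL]) (rule arg_cong[where f = "\<lambda>A. real (card A) / _"], auto)
  also have "\<dots> = (card (X - G) / card X) ^ r"
    using assms(1) by (simp add: card_lists_length_eq power_divide)
  also have "\<dots> \<le> (1 / 2) ^ r"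
    using assms(4) cardX by (intro power_mono) (auto simp: field_simps simp flip: of_nat_mult)
  finally show ?thesis
    using measure_pmf.prob_compl[of "{xs. set xs \<inter> G \<noteq> {}}" "pmf_of_set ?L"]
    by (simp add: power_divide)
qed

section \<open>The query algorithm\<close>

text \<open>A non-adaptive tree: the order of queries is fixed, and the continuation
  \<open>f\<close> finally receives the set of those answered yes.\<close>

primrec ask_all :: "'a set list list \<Rightarrow> ('a set list set \<Rightarrow> bool) \<Rightarrow> 'a query_alg" where
  "ask_all [] f = Output (f {})"
| "ask_all (As # Qs) f = Query As (\<lambda>b. ask_all Qs (\<lambda>P. f (if b then insert As P else P)))"

lemma run_ask_all: "run orc (ask_all Qs f) = f {As \<in> set Qs. orc As}"
proof (induction Qs arbitrary: f)
  case (Cons As Qs)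
  have "{Bs \<in> set (As # Qs). orc Bs}
      = (if orc As then insert As {Bs \<in> set Qs. orc Bs} else {Bs \<in> set Qs. orc Bs})" by auto
  then show ?case using Cons by simp
qed simp

lemma queries_ask_all: "queries orc (ask_all Qs f) = Qs"
  by (induction Qs arbitrary: f) auto

text \<open>Indexed by a vertex instead of a colour, so that the classes of vertices in
  \<open>U\<close> are nonempty, as the oracle demands.\<close>

definition colour_class :: "'a set \<Rightarrow> ('a \<Rightarrow> nat) \<Rightarrow> 'a \<Rightarrow> 'a set" where
  "colour_class U h u = {v \<in> U. h v = h u}"

definition class_tuples :: "nat \<Rightarrow> 'a set \<Rightarrow> ('a \<Rightarrow> nat) \<Rightarrow> 'a set list set" where
  "class_tuples d U h = {As. set As \<subseteq> colour_class U h ` U \<and> length As = d \<and> distinct As}"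

text \<open>\<open>S\<close> is a set of classes, so this says that the hypergraph on the classes of
  \<open>h\<close> has a small hitting set. The intersection discards the yes-answers in
  \<open>P\<close> that stem from other colourings.\<close>

definition classes_hit_by :: "nat \<Rightarrow> 'a set \<Rightarrow> nat \<Rightarrow> 'a set list set \<Rightarrow> ('a \<Rightarrow> nat) \<Rightarrow> bool" where
  "classes_hit_by d U k P h \<longleftrightarrow>
    (\<exists>S. finite S \<and> card S \<le> k \<and> (\<forall>As \<in> P \<inter> class_tuples d U h. S \<inter> set As \<noteq> {}))"

definition colouring_alg :: "nat \<Rightarrow> 'a set \<Rightarrow> nat \<Rightarrow> ('a \<Rightarrow> nat) list \<Rightarrow> 'a query_alg" where
  "colouring_alg d U k hs =
    ask_all (SOME Qs. distinct Qs \<and> set Qs = (\<Union>h\<in>set hs. class_tuples d U h))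
      (\<lambda>P. \<forall>h\<in>set hs. classes_hit_by d U k P h)"

lemma finite_class_tuples:
  assumes "finite U" shows "finite (class_tuples d U h)"
  by (rule finite_subset[OF _ finite_lists_length_eq[of "colour_class U h ` U" d]])
    (auto simp: class_tuples_def assms)

lemma card_class_tuples:
  assumes "finite U" "h ` U \<subseteq> {..<m}"
  shows "card (class_tuples d U h) \<le> m ^ d"
proof -
  have eq: "colour_class U h ` U = (\<lambda>c. {v \<in> U. h v = c}) ` h ` U"
    by (auto simp: colour_class_def)
  have "card (colour_class U h ` U) \<le> card (h ` U)"
    unfolding eq by (rule card_image_le) (simp add: assms)
  also have "\<dots> \<le> m" using card_mono[OF _ assms(2)] by simp
  finally have "card (colour_class U h ` U) \<le> m" .
  moreover have "card (class_tuples d U h) \<le> card {As. set As \<subseteq> colour_class U h ` U \<and> length As = d}"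
    by (intro card_mono finite_lists_length_eq) (auto simp: class_tuples_def assms)
  ultimately show ?thesis
    using assms(1) by (simp add: card_lists_length_eq) (meson le_trans power_mono zero_le)
qed

lemma class_tuple_is_query:
  assumes "As \<in> class_tuples d U h" shows "gpis_query d U As"
proof -
  have len: "length As = d" and dist: "distinct As"
    and cls: "\<And>i. i < d \<Longrightarrow> \<exists>u\<in>U. As ! i = colour_class U h u"
    using assms by (auto simp: class_tuples_def dest!: subsetD[OF _ nth_mem])
  have "As ! i \<inter> As ! j = {}" if "i < d" "j < d" "i \<noteq> j" for i j
  proof -
    have "As ! i \<noteq> As ! j" using that dist len by (simp add: nth_eq_iff_index_eq)
    then show ?thesis using cls[OF that(1)] cls[OF that(2)] by (auto simp: colour_class_def)
  qed
  with len cls show ?thesis by (fastforce simp: gpis_query_def colour_class_def)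
qed

context
  fixes d k :: nat and U :: "'a set" and hs :: "('a \<Rightarrow> nat) list"
  assumes finU: "finite U"
begin

lemma queries_colouring_alg:
  shows "distinct (queries orc (colouring_alg d U k hs))"
    and "set (queries orc (colouring_alg d U k hs)) = (\<Union>h\<in>set hs. class_tuples d U h)"
proof -
  have "finite (\<Union>h\<in>set hs. class_tuples d U h)" using finU by (simp add: finite_class_tuples)
  from someI_ex[OF finite_distinct_list[OF this, unfolded conj_commute[of "set _ = _"]]]
  show "distinct (queries orc (colouring_alg d U k hs))"
    and "set (queries orc (colouring_alg d U k hs)) = (\<Union>h\<in>set hs. class_tuples d U h)"
    by (auto simp: colouring_alg_def queries_ask_all)
qed

text \<open>The test for \<open>h\<close> reads the answers only at tuples of \<open>h\<close>, all
  of which were asked. So the finite record of answers may be replaced by the whole oracle.\<close>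

lemma run_colouring_alg:
  "run orc (colouring_alg d U k hs)
    \<longleftrightarrow> (\<forall>h\<in>set hs. classes_hit_by d U k {As. orc As} h)"
proof -
  let ?Q = "\<Union>h\<in>set hs. class_tuples d U h"
  have "classes_hit_by d U k {As \<in> ?Q. orc As} h = classes_hit_by d U k {As. orc As} h"
    if "h \<in> set hs" for h
  proof -
    have "{As \<in> ?Q. orc As} \<inter> class_tuples d U h = {As. orc As} \<inter> class_tuples d U h"
      using that by blast
    then show ?thesis by (simp only: classes_hit_by_def)
  qed
  then show ?thesis
    using queries_colouring_alg(2)[of orc]
    by (simp add: colouring_alg_def run_ask_all queries_ask_all)
qed

lemma length_queries_colouring_alg:
  assumes "\<And>h. h \<in> set hs \<Longrightarrow> h ` U \<subseteq> {..<m}"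
  shows "length (queries orc (colouring_alg d U k hs)) \<le> length hs * m ^ d"
proof -
  have "length (queries orc (colouring_alg d U k hs)) = card (\<Union>h\<in>set hs. class_tuples d U h)"
    using queries_colouring_alg distinct_card by metis
  also have "\<dots> \<le> (\<Sum>h\<in>set hs. card (class_tuples d U h))" by (rule card_UN_le) simp
  also have "\<dots> \<le> card (set hs) * m ^ d"
    using sum_bounded_above[OF card_class_tuples[OF finU assms]] by simp
  also have "\<dots> \<le> length hs * m ^ d" by (intro mult_right_mono card_length) simp
  finally show ?thesis .
qed

end

section \<open>Correctness of a single colouring\<close>

lemma classes_hit_if_hitting_set:
  assumes "finite U" "has_hitting_set_of_size_le U F k"
  shows "classes_hit_by d U k {As. gpis_oracle d F As} h"
proof -
  obtain T where T: "T \<subseteq> U" "card T \<le> k" "\<And>e. e \<in> F \<Longrightarrow> T \<inter> e \<noteq> {}"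
    using assms(2) by (auto simp: has_hitting_set_of_size_le_def hitting_set_def)
  have finT: "finite T" using T(1) assms(1) finite_subset by blast
  \<comment> \<open>The projection of \<open>T\<close>. A yes-answer is witnessed by an edge, which
    meets \<open>T\<close> in some \<open>u i\<close>, and the class containing \<open>u i\<close>
    is in \<open>?S\<close>. No property of \<open>h\<close> enters, so yes-instances are never
    rejected.\<close>
  let ?S = "colour_class U h ` T"
  have "?S \<inter> set As \<noteq> {}" if As: "gpis_oracle d F As" "As \<in> class_tuples d U h" for As
  proof -
    obtain u where u: "\<forall>i<d. u i \<in> As ! i" "u ` {..<d} \<in> F"
      using As(1) by (auto simp: gpis_oracle_def)
    then obtain i where i: "i < d" "u i \<in> T" using T(3)[OF u(2)] by auto
    have mem: "As ! i \<in> set As" and sub: "set As \<subseteq> colour_class U h ` U"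
      using As(2) i by (auto simp: class_tuples_def)
    then obtain v where "As ! i = colour_class U h v" by blast
    then have "As ! i = colour_class U h (u i)" using u(1) i by (auto simp: colour_class_def)
    with mem i show ?thesis by auto
  qed
  moreover have "card ?S \<le> k" using card_image_le[OF finT] T(2) le_trans by blast
  ultimately show ?thesis unfolding classes_hit_by_def using finT by blast
qed

lemma classes_not_hit_if_injective:
  assumes "uniform_hypergraph d U F" "G \<subseteq> F" "\<not> has_hitting_set_of_size_le U G k"
    and inj: "inj_on h (\<Union>G)"
  shows "\<not> classes_hit_by d U k {As. gpis_oracle d F As} h"
proof
  assume "classes_hit_by d U k {As. gpis_oracle d F As} h"
  then obtain S where S: "finite S" "card S \<le> k"
      "\<And>As. gpis_oracle d F As \<Longrightarrow> As \<in> class_tuples d U h \<Longrightarrow> S \<inter> set As \<noteq> {}"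
    by (auto simp: classes_hit_by_def)
  have finU: "finite U" and F: "\<And>e. e \<in> F \<Longrightarrow> e \<subseteq> U \<and> card e = d"
    using assms(1) by (auto simp: uniform_hypergraph_def)
  have GU: "\<Union>G \<subseteq> U" using F assms(2) by blast
  have injc: "inj_on (colour_class U h) (\<Union>G)"
  proof (rule inj_onI)
    fix u v assume uv: "u \<in> \<Union>G" "v \<in> \<Union>G" "colour_class U h u = colour_class U h v"
    then have "u \<in> colour_class U h v" using GU by (auto simp: colour_class_def)
    then show "u = v" using inj uv by (auto simp: colour_class_def dest: inj_onD)
  qed
  \<comment> \<open>The set of classes is pulled back to vertices of \<open>G\<close>. Injectivity
    of \<open>h\<close> there makes \<open>T\<close> no larger than \<open>S\<close>.\<close>
  define T where "T = {u \<in> \<Union>G. colour_class U h u \<in> S}"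
  have "card T \<le> card S"
    by (rule card_inj_on_le[OF inj_on_subset[OF injc] _ S(1)]) (auto simp: T_def)
  moreover have "T \<inter> e \<noteq> {}" if e: "e \<in> G" for e
  proof -
    have eF: "e \<in> F" using e assms(2) by blast
    then obtain us where us: "set us = e" "distinct us"
      using F finU finite_distinct_list finite_subset by metis
    have len: "length us = d" using us F[OF eF] distinct_card by metis
    let ?As = "map (colour_class U h) us"
    \<comment> \<open>Injectivity on \<open>e\<close> keeps its \<open>d\<close> classes distinct,
      so this tuple is really asked, and \<open>e\<close> itself witnesses a yes.\<close>
    have "?As \<in> class_tuples d U h"
      using us len F[OF eF] e inj_on_subset[OF injc, of e]
      by (auto simp: class_tuples_def distinct_map)
    moreover have "gpis_oracle d F ?As"
      unfolding gpis_oracle_def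
    proof (intro exI[of _ "\<lambda>i. us ! i"] conjI allI impI)
      show "us ! i \<in> ?As ! i" if "i < d" for i
        using that len F[OF eF] us by (auto simp: colour_class_def)
      have "(!) us ` {..<d} = e" using us(1) len by (auto simp: set_conv_nth)
      then show "(!) us ` {..<d} \<in> F" using eF by simp
    qed
    ultimately have "S \<inter> set ?As \<noteq> {}" using S(3) by blast
    then show ?thesis using us(1) e by (auto simp: T_def)
  qed
  ultimately have "has_hitting_set_of_size_le U G k"
    using GU S(2) unfolding has_hitting_set_of_size_le_def hitting_set_def
    by (intro exI[of _ T]) (auto simp: T_def)
  with assms(3) show False ..
qed

section \<open>Parameters and amplification\<close>

text \<open>Twice the square of the number of vertices that a critical subfamily can span: at most
  \<open>(d * Suc k) ^ d\<close> edges with \<open>d\<close> vertices each.\<close>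

definition num_colours :: "nat \<Rightarrow> nat \<Rightarrow> nat" where
  "num_colours d k = 2 * (d * (d * Suc k) ^ d)\<^sup>2"

definition colourings :: "nat \<Rightarrow> 'a set \<Rightarrow> nat \<Rightarrow> ('a \<Rightarrow> nat) set" where
  "colourings d U k = U \<rightarrow>\<^sub>E {..<num_colours d k}"

lemma colourings_finite_nonempty:
  assumes "finite U" "d > 0"
  shows "finite (colourings d U k)" "colourings d U k \<noteq> {}"
  using assms by (auto simp: colourings_def num_colours_def finite_PiE PiE_eq_empty_iff lessThan_empty_iff)

text \<open>A colouring that fails to reject must merge two vertices of a fixed critical subfamily
  \<open>G\<close>. \<open>num_colours\<close> is large enough for the birthday bound on these
  vertices.\<close>

lemma half_of_colourings_detect:
  assumes "uniform_hypergraph d U F" "\<not> has_hitting_set_of_size_le U F k"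
  shows "2 * card {h \<in> colourings d U k. classes_hit_by d U k {As. gpis_oracle d F As} h}
    \<le> card (colourings d U k)"
proof -
  have finU: "finite U" and F: "\<And>e. e \<in> F \<Longrightarrow> e \<subseteq> U \<and> card e = d"
    using assms(1) by (auto simp: uniform_hypergraph_def)
  obtain G where G: "G \<subseteq> F" "\<not> has_hitting_set_of_size_le U G k" "card G \<le> (d * Suc k) ^ d"
    using no_small_hitting_set_subfamily[OF assms] by blast
  have "card (\<Union>G) \<le> (\<Sum>e\<in>G. card e)" by (rule card_Union_le_sum_card)
  also have "\<dots> = card G * d" using F G(1) by (subst sum.cong[OF refl, of _ _ "\<lambda>_. d"]) auto
  also have "\<dots> \<le> d * (d * Suc k) ^ d" using G(3) by (simp add: mult.commute)
  finally have "2 * (card (\<Union>G))\<^sup>2 \<le> num_colours d k"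
    unfolding num_colours_def by (intro mult_left_mono power_mono) auto
  moreover have "\<Union>G \<subseteq> U" using F G(1) by blast
  ultimately have "2 * card {h \<in> colourings d U k. \<not> inj_on h (\<Union>G)} \<le> num_colours d k ^ card U"
    unfolding colourings_def using card_noninjective_colourings[OF finU] by blast
  also have "\<dots> = card (colourings d U k)" using finU by (simp add: colourings_def card_PiE)
  finally have *: "2 * card {h \<in> colourings d U k. \<not> inj_on h (\<Union>G)} \<le> card (colourings d U k)" .
  have "finite (colourings d U k)" using finU by (auto simp: colourings_def intro: finite_PiE)
  then have "card {h \<in> colourings d U k. classes_hit_by d U k {As. gpis_oracle d F As} h}
      \<le> card {h \<in> colourings d U k. \<not> inj_on h (\<Union>G)}"
    using classes_not_hit_if_injective[OF assms(1) G(1,2)] by (intro card_mono) auto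
  with * show ?thesis by linarith
qed

text \<open>Enough halvings to bring the error down to \<open>1/k\<close>. For \<open>k = 1\<close>
  there are no rounds: the algorithm accepts without a query, and the required probability is
  zero.\<close>

definition num_rounds :: "nat \<Rightarrow> nat" where
  "num_rounds k = nat \<lceil>log 2 (real k)\<rceil>"

lemma le_two_power_num_rounds:
  assumes "k \<ge> 1" shows "real k \<le> 2 ^ num_rounds k"
proof -
  have "log 2 (real k) \<le> real (num_rounds k)" by (simp add: num_rounds_def of_nat_ceiling)
  then have "real k \<le> 2 powr real (num_rounds k)" using assms by (simp add: log_le_iff)
  then show ?thesis by (simp add: powr_realpow)
qed

lemma num_queries_bigo:
  "(\<lambda>k. real (num_rounds k * num_colours d k ^ d)) \<in> O(\<lambda>k. real k ^ (2 * d\<^sup>2) * ln (real k))"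
proof (rule bigoI)
  \<comment> \<open>The leading constant of \<open>num_colours\<close> after bounding
    \<open>1 + k\<close> by \<open>2 * k\<close> and factoring out the power of
    \<open>k\<close>.\<close>
  define B where "B = 2 * (real d * (2 * real d) ^ d)\<^sup>2"
  show "\<forall>\<^sub>F k in sequentially. norm (real (num_rounds k * num_colours d k ^ d))
      \<le> (2 / ln 2 * B ^ d) * norm (real k ^ (2 * d\<^sup>2) * ln (real k))"
    using eventually_ge_at_top[of 2]
  proof eventually_elim
    case (elim k)
    have ln2: "ln 2 \<le> ln (real k)" using elim by simp
    have "log 2 (real k) \<ge> 1" using elim by simp
    then have "real (num_rounds k) \<le> log 2 (real k) + 1" unfolding num_rounds_def by linarith
    \<comment> \<open>From \<open>k = 2\<close> on, \<open>log 2 k\<close> is at least 1 and absorbs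
      the loss from rounding up.\<close>
    also have "\<dots> \<le> 2 / ln 2 * ln (real k)" using ln2 by (simp add: log_def field_simps)
    finally have r: "real (num_rounds k) \<le> 2 / ln 2 * ln (real k)" .
    have "real (num_colours d k) = 2 * (real d * (real d * (1 + real k)) ^ d)\<^sup>2"
      unfolding num_colours_def by (simp only: of_nat_mult of_nat_power of_nat_Suc of_nat_numeral)
    also have "\<dots> \<le> 2 * (real d * (real d * (2 * real k)) ^ d)\<^sup>2"
      using elim by (intro mult_left_mono power_mono) auto
    also have "\<dots> = B * real k ^ (2 * d)"
    proof -
      have "real k ^ (2 * d) = (real k ^ d)\<^sup>2" by (simp add: mult.commute flip: power_mult)
      then show ?thesis by (simp only: B_def power_mult_distrib mult_ac)
    qed
    finally have "real (num_colours d k) ^ d \<le> (B * real k ^ (2 * d)) ^ d"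
      by (intro power_mono) auto
    also have "\<dots> = B ^ d * real k ^ (2 * d\<^sup>2)"
      by (simp add: power_mult_distrib power2_eq_square mult.assoc flip: power_mult)
    finally have "real (num_rounds k) * real (num_colours d k) ^ d
        \<le> (2 / ln 2 * ln (real k)) * (B ^ d * real k ^ (2 * d\<^sup>2))"
      using r elim by (intro mult_mono) auto
    then show ?case using elim by (simp add: mult_ac abs_mult)
  qed
qed

text \<open>All colourings are drawn in advance. Uniformity over lists of fixed length makes the
  rounds independent, and each list fixes one deterministic tree.\<close>

definition random_colouring_alg :: "nat \<Rightarrow> 'a set \<Rightarrow> nat \<Rightarrow> 'a rand_query_alg" where
  "random_colouring_alg d U k = map_pmf (colouring_alg d U k)
    (pmf_of_set {hs. set hs \<subseteq> colourings d U k \<and> length hs = num_rounds k})"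

lemma random_colouring_alg_queries:
  assumes "finite U" "d > 0" "t \<in> set_pmf (random_colouring_alg d U k)"
  shows "(\<forall>As\<in>set (queries orc t). gpis_query d U As)
    \<and> length (queries orc t) \<le> num_rounds k * num_colours d k ^ d"
proof -
  let ?L = "{hs. set hs \<subseteq> colourings d U k \<and> length hs = num_rounds k}"
  note X = colourings_finite_nonempty[OF assms(1,2), of k]
  have finL: "finite ?L" using X(1) by (rule finite_lists_length_eq)
  obtain h where "h \<in> colourings d U k" using X(2) by blast
  then have "replicate (num_rounds k) h \<in> ?L" by auto
  then have "?L \<noteq> {}" by blast
  then obtain hs where hs: "set hs \<subseteq> colourings d U k" "length hs = num_rounds k"
      and t: "t = colouring_alg d U k hs"
    using assms(3) finL by (auto simp: random_colouring_alg_def)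
  have "\<And>h. h \<in> set hs \<Longrightarrow> h ` U \<subseteq> {..<num_colours d k}"
    using hs(1) by (auto simp: colourings_def)
  then have "length (queries orc t) \<le> num_rounds k * num_colours d k ^ d"
    unfolding t hs(2)[symmetric] by (rule length_queries_colouring_alg[OF assms(1)])
  moreover have "\<forall>As\<in>set (queries orc t). gpis_query d U As"
    using queries_colouring_alg(2)[OF assms(1), of orc d k hs] class_tuple_is_query
    by (auto simp: t)
  ultimately show ?thesis by blast
qed

lemma random_colouring_alg_correct:
  assumes "uniform_hypergraph d U F" "d > 0" "k \<ge> 1"
  shows "measure_pmf.prob (random_colouring_alg d U k)
      {t. run (gpis_oracle d F) t \<longleftrightarrow> has_hitting_set_of_size_le U F k} \<ge> 1 - 1 / real k"
proof -
  let ?orc = "gpis_oracle d F"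
  let ?hit = "classes_hit_by d U k {As. ?orc As}"
  have finU: "finite U" using assms(1) by (simp add: uniform_hypergraph_def)
  note run = run_colouring_alg[OF finU, of ?orc d k]
  show ?thesis
  proof (cases "has_hitting_set_of_size_le U F k")
    case True
    then have "run ?orc (colouring_alg d U k hs)" for hs
      using classes_hit_if_hitting_set[OF finU] run by blast
    then show ?thesis using True by (simp add: random_colouring_alg_def vimage_def)
  next
    case False
    \<comment> \<open>\<open>?G\<close> holds the detecting colourings. The run rejects as soon as
      one of them occurs in the list.\<close>
    let ?X = "colourings d U k" and ?G = "{h \<in> colourings d U k. \<not> ?hit h}"
    let ?p = "pmf_of_set {hs. set hs \<subseteq> ?X \<and> length hs = num_rounds k}"
    have "?X - ?G = {h \<in> ?X. ?hit h}" by blast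
    then have "2 * card (?X - ?G) \<le> card ?X"
      using half_of_colourings_detect[OF assms(1) False] by simp
    then have "measure_pmf.prob ?p {hs. set hs \<inter> ?G \<noteq> {}} \<ge> 1 - 1 / 2 ^ num_rounds k"
      using colourings_finite_nonempty[OF finU assms(2)] by (intro prob_lists_avoiding) auto
    moreover have "1 / 2 ^ num_rounds k \<le> 1 / real k"
      using le_two_power_num_rounds[OF assms(3)] assms(3) by (intro divide_left_mono) auto
    moreover have "measure_pmf.prob ?p {hs. set hs \<inter> ?G \<noteq> {}}
        \<le> measure_pmf.prob ?p (colouring_alg d U k -` {t. \<not> run ?orc t})"
      by (rule measure_pmf.finite_measure_mono) (auto simp: run)
    ultimately show ?thesis using False by (simp add: random_colouring_alg_def vimage_def)
  qed
qed

theorem theorem6: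
  fixes d :: nat
  assumes "d \<ge> 2"
  shows "\<exists>(alg :: 'a set \<Rightarrow> nat \<Rightarrow> 'a rand_query_alg) (q :: nat \<Rightarrow> nat) (c :: real).
    c > 0 \<and>
    (\<lambda>k. real (q k)) \<in> O(\<lambda>k. real k ^ (2 * d\<^sup>2) * ln (real k)) \<and>
    (\<forall>U F k. uniform_hypergraph d U F \<longrightarrow> k \<ge> 1 \<longrightarrow>
      (\<forall>t\<in>set_pmf (alg U k).
         (\<forall>As\<in>set (queries (gpis_oracle d F) t). gpis_query d U As) \<and>
         length (queries (gpis_oracle d F) t) \<le> q k) \<and>
      measure_pmf.prob (alg U k)
        {t. run (gpis_oracle d F) t \<longleftrightarrow> has_hitting_set_of_size_le U F k}
        \<ge> 1 - 1 / real k powr c)"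
proof (intro exI[of _ "random_colouring_alg d"]
    exI[of _ "\<lambda>k. num_rounds k * num_colours d k ^ d"] exI[of _ "1 :: real"] conjI allI impI)
  fix U :: "'a set" and F and k :: nat
  assume H: "uniform_hypergraph d U F" and k: "k \<ge> 1"
  have finU: "finite U" using H by (simp add: uniform_hypergraph_def)
  show "\<forall>t\<in>set_pmf (random_colouring_alg d U k).
      (\<forall>As\<in>set (queries (gpis_oracle d F) t). gpis_query d U As) \<and>
      length (queries (gpis_oracle d F) t) \<le> num_rounds k * num_colours d k ^ d"
  proof
    fix t assume "t \<in> set_pmf (random_colouring_alg d U k)"
    with assms show "(\<forall>As\<in>set (queries (gpis_oracle d F) t). gpis_query d U As) \<and>
        length (queries (gpis_oracle d F) t) \<le> num_rounds k * num_colours d k ^ d"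
      by (intro random_colouring_alg_queries finU) linarith
  qed
  \<comment> \<open>The choice \<open>c = 1\<close> matches the error \<open>1/k\<close> guaranteed
    by \<open>num_rounds\<close>.\<close>
  show "measure_pmf.prob (random_colouring_alg d U k)
      {t. run (gpis_oracle d F) t \<longleftrightarrow> has_hitting_set_of_size_le U F k} \<ge> 1 - 1 / real k powr 1"
    using random_colouring_alg_correct[OF H _ k] assms k by simp
qed (simp_all only: num_queries_bigo zero_less_one)

end
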